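(* Let $\mu=(\mu_1,\ldots,\mu_l)$ be a composition of $m$ (positive integers with sum $m$) with code $\alpha$. Suppose that $\alpha$ can be written as $$\alpha=\cdots\beta_3\beta_2\beta_1L^kU\gamma_1\gamma_2\gamma_3\cdots$$ for some integer $k\ge1$, where every $\beta_i\in\{R,U\}$, $\beta_1=U$, and the $\gamma_i$ are letters. (1) If $\beta_k=U$, then $B_{\mu_1}\cdots B_{\mu_l}=0$. (2) If $\beta_k=R$, then the reduced form of the word $\cdots\beta_{k+2}\beta_{k+1}U\beta_{k-1}\cdots\beta_2\beta_1L^{k-1}\gamma_1\gamma_2\gamma_3\cdots$ is the code of a composition $\nu=(\nu_1,\ldots,\nu_l)$ of $m$, and $B_{\mu_1}\cdots B_{\mu_l}=(-1)^jB_{\nu_1}\cdots B_{\nu_l}$, where $j$ is the number of letters $U$ among $\beta_{k-1},\ldots,\beta_2,\beta_1$.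
   Context: $\Lambda=\mathbb{C}[p_1,p_2,\ldots]$ is the ring of symmetric functions, $p_k$ the power sums; the Bernstein operators $B_n$ ($n\in\mathbb{Z}$) on $\Lambda$ are defined by $\sum_{n\in\mathbb{Z}}B_nt^n=\exp\big(\sum_{k\ge1}\frac{t^k}{k}p_k\big)\exp\big(-\sum_{k\ge1}t^{-k}\frac{\partial}{\partial p_k}\big)$, and products denote composition. Codes: words are bi-infinite sequences over the alphabet $\{R,L,U\}$. For integers $a,b\ge0$ let $H(a,b)=R^{b-a}$ if $b\ge a$ and $H(a,b)=L^{a-b}$ if $a>b$ (exponents denote repetition). The code of a composition $\mu=(\mu_1,\ldots,\mu_l)$ of positive integers is the word $$\cdots UUU\,R^{\mu_l}\,U\,H(\mu_l,\mu_{l-1})\,U\,H(\mu_{l-1},\mu_{l-2})\,U\cdots U\,H(\mu_2,\mu_1)\,U\,RRR\cdots,$$ i.e. the sequence of unit right ($R$), left ($L$) and up ($U$) steps along the right boundary of the diagram with left-justified rows of lengths $\mu_1,\ldots,\mu_l$ (top to bottom) in the fourth quadrant, extended by the negative $y$-axis and the positive $x$-axis. The reduced form of a word is obtained by repeatedly deleting adjacent pairs $LR$ or $RL$; codes of compositions are reduced, and distinct compositions have distinct codes. *)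

theory Defs
  imports Complex_Main "HOL-Library.Poly_Mapping"
begin

section \<open>Symmetric functions and Bernstein operators\<close>

text \<open>
  Symmetric functions are polynomials in the power sums. A monomial is a finitely supported
  exponent function; since the power sums are indexed from 1, the variable with number \<open>i\<close> stands
  for \<open>p\<^sub>i\<^sub>+\<^sub>1\<close>.
\<close>

type_synonym symfun = "(nat \<Rightarrow>\<^sub>0 nat) \<Rightarrow>\<^sub>0 complex"

definition scalar :: "complex \<Rightarrow> symfun" where
  "scalar c = Poly_Mapping.single 0 c"

text \<open>\<open>powersum k\<close> and \<open>pderiv_powersum k\<close> are meant for \<open>k \<ge> 1\<close>.\<close>

definition powersum :: "nat \<Rightarrow> symfun" where
  "powersum k = Poly_Mapping.single (Poly_Mapping.single (k - 1) 1) 1"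

definition pderiv_powersum :: "nat \<Rightarrow> symfun \<Rightarrow> symfun" where
  "pderiv_powersum k f =
     (\<Sum>m\<in>Poly_Mapping.keys f.
        Poly_Mapping.single (m - Poly_Mapping.single (k - 1) 1)
          (of_nat (Poly_Mapping.lookup m (k - 1)) * Poly_Mapping.lookup f m))"

text \<open>
  A formal power series \<open>\<Sum>n. A\<^sub>n s\<^sup>n\<close> whose coefficients are operators on symmetric functions is the
  function \<open>n \<mapsto> A\<^sub>n\<close>. The product of two series is the Cauchy product, the product of
  coefficients being composition.
\<close>

type_synonym opseries = "nat \<Rightarrow> symfun \<Rightarrow> symfun"

definition op_one :: opseries where
  "op_one n f = (if n = 0 then f else 0)"

definition op_mult :: "opseries \<Rightarrow> opseries \<Rightarrow> opseries" where
  "op_mult A A' n f = (\<Sum>i\<le>n. A i (A' (n - i) f))"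

definition op_power :: "opseries \<Rightarrow> nat \<Rightarrow> opseries" where
  "op_power A r = (op_mult A ^^ r) op_one"

text \<open>
  The exponential \<open>\<Sum>r. A\<^sup>r / r!\<close> of a series without constant term: only the powers with \<open>r \<le> n\<close>
  contribute to the coefficient of \<open>s\<^sup>n\<close>.
\<close>

definition op_exp :: "opseries \<Rightarrow> opseries" where
  "op_exp A n f = (\<Sum>r\<le>n. scalar (1 / fact r) * op_power A r n f)"

definition raising :: opseries where
  "raising k f = (if k = 0 then 0 else scalar (1 / of_nat k) * powersum k * f)"

definition lowering :: opseries where
  "lowering k f = (if k = 0 then 0 else - pderiv_powersum k f)"

text \<open>
  The first exponential is a series in \<open>t\<close>, the second one a series in \<open>t\<^sup>-\<^sup>1\<close>; the coefficient of
  \<open>t\<^sup>n\<close> in their product collects the pairs of exponents \<open>n + j\<close> and \<open>j\<close>. The sum is finite, by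
  \<open>finite_op_exp_lowering\<close> below.
\<close>

definition bernstein :: "int \<Rightarrow> symfun \<Rightarrow> symfun" where
  "bernstein n f =
     (\<Sum>j | 0 \<le> n + int j \<and> op_exp lowering j f \<noteq> 0.
        op_exp raising (nat (n + int j)) (op_exp lowering j f))"

definition bernstein_prod :: "nat list \<Rightarrow> symfun \<Rightarrow> symfun" where
  "bernstein_prod \<mu> = foldr (\<lambda>a F. bernstein (int a) \<circ> F) \<mu> id"

definition mon_weight :: "(nat \<Rightarrow>\<^sub>0 nat) \<Rightarrow> nat" where
  "mon_weight m = (\<Sum>i\<in>Poly_Mapping.keys m. Suc i * Poly_Mapping.lookup m i)"

lemma mon_weight_superset:
  assumes "finite S" "Poly_Mapping.keys m \<subseteq> S"
  shows "mon_weight m = (\<Sum>i\<in>S. Suc i * Poly_Mapping.lookup m i)"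
  unfolding mon_weight_def
  by (rule sum.mono_neutral_left) (use assms in \<open>auto simp: in_keys_iff\<close>)

lemma mon_weight_minus_single:
  assumes "Poly_Mapping.lookup m i \<noteq> 0"
  shows "mon_weight (m - Poly_Mapping.single i 1) + Suc i = mon_weight m"
proof -
  let ?K = "Poly_Mapping.keys m" and ?m' = "m - Poly_Mapping.single i 1"
  have i: "i \<in> ?K" using assms by (simp add: in_keys_iff)
  have "Poly_Mapping.keys ?m' \<subseteq> ?K"
    by (auto simp: in_keys_iff lookup_minus)
  then have "mon_weight ?m' = (\<Sum>a\<in>?K. Suc a * Poly_Mapping.lookup ?m' a)"
    by (intro mon_weight_superset) auto
  also have "\<dots> = Suc i * (Poly_Mapping.lookup m i - 1)
      + (\<Sum>a\<in>?K - {i}. Suc a * Poly_Mapping.lookup ?m' a)"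
    using i by (subst sum.remove[where x = i]) (auto simp: lookup_minus lookup_single)
  also have "(\<Sum>a\<in>?K - {i}. Suc a * Poly_Mapping.lookup ?m' a)
      = (\<Sum>a\<in>?K - {i}. Suc a * Poly_Mapping.lookup m a)"
    by (rule sum.cong) (auto simp: lookup_minus lookup_single when_def)
  finally have 1: "mon_weight ?m' = Suc i * (Poly_Mapping.lookup m i - 1)
      + (\<Sum>a\<in>?K - {i}. Suc a * Poly_Mapping.lookup m a)" .
  have 2: "mon_weight m = Suc i * Poly_Mapping.lookup m i
      + (\<Sum>a\<in>?K - {i}. Suc a * Poly_Mapping.lookup m a)"
    unfolding mon_weight_def using i by (subst sum.remove[where x = i]) auto
  obtain q where q: "Poly_Mapping.lookup m i = Suc q"
    using assms not0_implies_Suc by blast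
  show ?thesis using 1 2 unfolding q by simp
qed

lemma keys_pderiv_powersum:
  assumes "m' \<in> Poly_Mapping.keys (pderiv_powersum k f)" "k \<ge> 1"
  shows "\<exists>m\<in>Poly_Mapping.keys f. mon_weight m' + k = mon_weight m"
proof -
  have "m' \<in> (\<Union>m\<in>Poly_Mapping.keys f. Poly_Mapping.keys
      (Poly_Mapping.single (m - Poly_Mapping.single (k - 1) 1)
        (of_nat (Poly_Mapping.lookup m (k - 1)) * Poly_Mapping.lookup f m)))"
    using assms(1) unfolding pderiv_powersum_def by (rule subsetD[OF keys_sum])
  then obtain m where m: "m \<in> Poly_Mapping.keys f" "Poly_Mapping.lookup m (k - 1) \<noteq> 0"
      "m' = m - Poly_Mapping.single (k - 1) 1"
    by (auto split: if_splits)
  then show ?thesis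
    using mon_weight_minus_single[OF m(2)] assms(2) by auto
qed

lemma keys_op_power_lowering:
  assumes "\<And>m. m \<in> Poly_Mapping.keys f \<Longrightarrow> mon_weight m \<le> d"
    and "m \<in> Poly_Mapping.keys (op_power lowering r j f)"
  shows "mon_weight m + j \<le> d"
  using assms(2)
proof (induction r arbitrary: j m)
  case 0
  then show ?case using assms(1) by (auto simp: op_power_def op_one_def split: if_splits)
next
  case (Suc r)
  have "m \<in> Poly_Mapping.keys (\<Sum>i\<le>j. lowering i (op_power lowering r (j - i) f))"
    using Suc.prems by (simp add: op_power_def op_mult_def)
  then obtain i where i: "i \<le> j"
      "m \<in> Poly_Mapping.keys (lowering i (op_power lowering r (j - i) f))"
    using keys_sum by fastforce
  then have "i \<ge> 1"
      "m \<in> Poly_Mapping.keys (pderiv_powersum i (op_power lowering r (j - i) f))"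
    by (auto simp: lowering_def split: if_splits)
  from keys_pderiv_powersum[OF this(2,1)] obtain m0 where
      "m0 \<in> Poly_Mapping.keys (op_power lowering r (j - i) f)" "mon_weight m + i = mon_weight m0"
    by blast
  then show ?case using Suc.IH[of m0 "j - i"] i(1) by simp
qed

lemma finite_op_exp_lowering: "finite {j. op_exp lowering j f \<noteq> 0}"
proof -
  define d where "d = (\<Sum>m\<in>Poly_Mapping.keys f. mon_weight m)"
  have d: "mon_weight m \<le> d" if "m \<in> Poly_Mapping.keys f" for m
    unfolding d_def by (rule member_le_sum) (use that in auto)
  have "op_exp lowering j f = 0" if "j > d" for j
  proof -
    have "Poly_Mapping.keys (op_power lowering r j f) = {}" for r
      using keys_op_power_lowering[OF d, of f] that by fastforce
    then show ?thesis by (simp add: op_exp_def)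
  qed
  then have "{j. op_exp lowering j f \<noteq> 0} \<subseteq> {..d}"
    using not_le by blast
  then show ?thesis by (rule finite_subset) simp
qed


section \<open>Compositions and their codes\<close>

definition is_composition :: "nat \<Rightarrow> nat list \<Rightarrow> bool" where
  "is_composition m \<mu> \<longleftrightarrow> (\<forall>a\<in>set \<mu>. 0 < a) \<and> sum_list \<mu> = m"

datatype letter = R | L | U

text \<open>
  Bi-infinite words are functions on the integers. The origin carries no meaning, so two
  functions give the same word if they agree up to a shift.
\<close>

type_synonym word = "int \<Rightarrow> letter"

definition same_word :: "word \<Rightarrow> word \<Rightarrow> bool" where
  "same_word v w \<longleftrightarrow> (\<exists>s. \<forall>i. w i = v (i + s))"

text \<open>
  The word \<open>\<dots> \<beta>\<^sub>3 \<beta>\<^sub>2 \<beta>\<^sub>1 ws \<gamma>\<^sub>1 \<gamma>\<^sub>2 \<gamma>\<^sub>3 \<dots>\<close>; the values \<open>\<beta> 0\<close> and \<open>\<gamma> 0\<close> are not used.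
\<close>

definition glue :: "(nat \<Rightarrow> letter) \<Rightarrow> letter list \<Rightarrow> (nat \<Rightarrow> letter) \<Rightarrow> word" where
  "glue \<beta> ws \<gamma> i =
     (if i < 0 then \<beta> (nat (- i))
      else if i < int (length ws) then ws ! nat i
      else \<gamma> (Suc (nat i - length ws)))"

definition hstep :: "nat \<Rightarrow> nat \<Rightarrow> letter list" where
  "hstep a b = (if a \<le> b then replicate (b - a) R else replicate (a - b) L)"

fun code_middle :: "nat list \<Rightarrow> letter list" where
  "code_middle [] = []"
| "code_middle [a] = replicate a R @ [U]"
| "code_middle (a # b # \<mu>) = code_middle (b # \<mu>) @ hstep b a @ [U]"

definition code :: "nat list \<Rightarrow> word" where
  "code \<mu> = glue (\<lambda>_. U) (code_middle \<mu>) (\<lambda>_. R)"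

definition cancelling :: "word \<Rightarrow> int \<Rightarrow> bool" where
  "cancelling w i \<longleftrightarrow> (w i = L \<and> w (i + 1) = R) \<or> (w i = R \<and> w (i + 1) = L)"

definition cancel_step :: "word \<Rightarrow> word \<Rightarrow> bool" where
  "cancel_step w v \<longleftrightarrow>
     (\<exists>i. cancelling w i \<and> v = (\<lambda>j. if j < i then w j else w (j + 2)))"

text \<open>\<open>is_reduced_form w v\<close>: finitely many deletions turn \<open>w\<close> into the reduced word \<open>v\<close>.\<close>

definition is_reduced_form :: "word \<Rightarrow> word \<Rightarrow> bool" where
  "is_reduced_form w v \<longleftrightarrow>
     (\<exists>u. cancel_step\<^sup>*\<^sup>* w u \<and> (\<forall>i. \<not> cancelling u i) \<and> same_word u v)"

end

theory Submission
  imports Defs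
begin

text \<open>
  Let \<open>h\<^sub>n\<close> and \<open>e\<^sub>n\<close> be the coefficients of \<open>H(t) = exp (\<Sum>k. t\<^sup>k p\<^sub>k / k)\<close> and
  \<open>E(s) = exp (- \<Sum>k. s\<^sup>k \<partial>/\<partial>p\<^sub>k)\<close>. Differentiating these series in \<open>t\<close> and \<open>s\<close> gives recursions for
  \<open>h\<^sub>n\<close> and \<open>e\<^sub>n\<close>, from which \<open>E(s) H(t) = (1 - s t) H(t) E(s)\<close> follows by induction. Hence
  \<open>B\<^sub>a B\<^sub>b = S(a, b) - S(a + 1, b - 1)\<close> with \<open>S(a, b) = \<Sum>i j. h\<^sub>a\<^sub>+\<^sub>i h\<^sub>b\<^sub>+\<^sub>j e\<^sub>i e\<^sub>j\<close> symmetric, so that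
  \<open>B\<^sub>a B\<^sub>b = - B\<^sub>b\<^sub>-\<^sub>1 B\<^sub>a\<^sub>+\<^sub>1\<close>, and in particular \<open>B\<^sub>a B\<^sub>a\<^sub>+\<^sub>1 = 0\<close>. If the letters \<open>L\<^sup>k\<close> lead to a row of
  length \<open>a\<close>, then the \<open>\<beta>\<^sub>i\<close> describe the rows below it. These are weakly decreasing, and \<open>B\<^sub>a\<close> is moved
  past them until the product vanishes or the next row is no longer than the moved one.
\<close>

section \<open>Linear operators on symmetric functions\<close>

abbreviation linear_op :: "(symfun \<Rightarrow> symfun) \<Rightarrow> bool" where
  "linear_op \<equiv> module_hom (\<lambda>c f. scalar c * f) (\<lambda>c f. scalar c * f)"

lemma scalar_add: "scalar (a + b) = scalar a + scalar b"
  by (simp add: scalar_def single_add)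

lemma scalar_mult: "scalar (a * b) = scalar a * scalar b"
  by (simp add: scalar_def mult_single)

lemma scalar_one: "scalar 1 = 1"
  by (simp add: scalar_def)

lemma scalar_of_nat: "scalar (of_nat n) = of_nat n"
  by (simp add: scalar_def)

lemma lookup_scalar_mult:
  "Poly_Mapping.lookup (scalar c * f) m = c * Poly_Mapping.lookup f m"
proof -
  have "scalar c * f = Poly_Mapping.map ((*) c) f"
    by (simp add: scalar_def mult_map_scale_conv_mult)
  then show ?thesis
    by (simp add: map.rep_eq when_def)
qed

lemma linear_opI:
  assumes "\<And>f g. F (f + g) = F f + F g" "\<And>c f. F (scalar c * f) = scalar c * F f"
  shows "linear_op F"
  by unfold_locales
    (use assms in \<open>auto simp: algebra_simps scalar_add scalar_mult scalar_one\<close>)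

lemma linear_op_of_nat:
  assumes "linear_op F"
  shows "F (of_nat n * f) = of_nat n * F f"
  using module_hom.scale[OF assms, of "of_nat n" f] by (simp add: scalar_of_nat)

lemma symfun_induct [case_names single add]:
  fixes f :: symfun
  assumes "\<And>m c. P (Poly_Mapping.single m c)" "\<And>f g. P f \<Longrightarrow> P g \<Longrightarrow> P (f + g)"
  shows "P f"
proof (induction f rule: update_induct)
  case const
  show ?case using assms(1)[of 0 0] by simp
next
  case (update f a b)
  have "Poly_Mapping.update a b f = f + Poly_Mapping.single a b"
    using update.hyps
    by (intro poly_mapping_eqI)
      (auto simp: lookup_update lookup_add lookup_single in_keys_iff)
  with assms update.IH show ?case by simp
qed

lemma sum_triangle_swap:
  fixes F :: "nat \<Rightarrow> nat \<Rightarrow> 'a::comm_monoid_add"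
  shows "(\<Sum>i\<le>n. \<Sum>k\<le>n - i. F i k) = (\<Sum>k\<le>n. \<Sum>i\<le>n - k. F i k)"
proof -
  have "(\<Sum>i\<le>n. \<Sum>k\<le>n - i. F i k) = (\<Sum>i\<le>n. \<Sum>k\<in>{k\<in>{..n}. i + k \<le> n}. F i k)"
    by (intro sum.cong) auto
  also have "\<dots> = (\<Sum>k\<le>n. \<Sum>i\<in>{i\<in>{..n}. i + k \<le> n}. F i k)"
    by (rule sum.swap_restrict) auto
  also have "\<dots> = (\<Sum>k\<le>n. \<Sum>i\<le>n - k. F i k)"
    by (intro sum.cong) auto
  finally show ?thesis .
qed

section \<open>Exponentials of commuting operators\<close>

text \<open>Isolates what \<open>raising\<close> and \<open>lowering\<close> share, so that the
  differential equation of the exponential is proved once for both. Commutativity is what makes the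
  power rule valid for operator coefficients.\<close>

locale commuting_series =
  fixes A :: opseries
  assumes linear: "linear_op (A k)"
    and zero_coeff: "A 0 f = 0"
    and commute: "A i (A j f) = A j (A i f)"
begin

lemma op_power_0: "op_power A 0 = op_one"
  by (simp add: op_power_def)

lemma op_power_Suc: "op_power A (Suc r) n f = (\<Sum>i\<le>n. A i (op_power A r (n - i) f))"
  by (simp add: op_power_def op_mult_def)

lemma op_power_commute:
  assumes "linear_op F" "\<And>k f. F (A k f) = A k (F f)"
  shows "F (op_power A r n f) = op_power A r n (F f)"
proof (induction r arbitrary: n)
  case 0
  show ?case using module_hom.zero[OF assms(1)] by (simp add: op_power_0 op_one_def)
next
  case (Suc r)
  then show ?case by (simp add: op_power_Suc module_hom.sum[OF assms(1)] assms(2))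
qed

lemma op_exp_commute:
  assumes "linear_op F" "\<And>k f. F (A k f) = A k (F f)"
  shows "F (op_exp A n f) = op_exp A n (F f)"
  using module_hom.scale[OF assms(1)]
  by (simp add: op_exp_def module_hom.sum[OF assms(1)] op_power_commute[OF assms])

lemma linear_op_power: "linear_op (op_power A r n)"
proof (rule linear_opI)
  show "op_power A r n (f + g) = op_power A r n f + op_power A r n g" for f g
    by (induction r arbitrary: n)
      (auto simp: op_power_0 op_one_def op_power_Suc module_hom.add[OF linear] sum.distrib)
  show "op_power A r n (scalar c * f) = scalar c * op_power A r n f" for c f
    by (induction r arbitrary: n)
      (auto simp: op_power_0 op_one_def op_power_Suc module_hom.scale[OF linear] sum_distrib_left)
qed

lemma linear_op_exp: "linear_op (op_exp A n)"
  unfolding op_exp_def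
  by (rule linear_opI) (simp_all add: module_hom.add[OF linear_op_power]
      module_hom.scale[OF linear_op_power] sum.distrib distrib_left sum_distrib_left mult.left_commute)

lemma op_exp_0: "op_exp A 0 f = f"
  by (simp add: op_exp_def op_power_0 op_one_def scalar_one)

text \<open>Without a constant term, the r-th power starts in degree r; hence the sum defining
  \<open>op_exp\<close> may be cut off at any later point.\<close>

lemma op_power_eq_0: "n < r \<Longrightarrow> op_power A r n f = 0"
proof (induction r arbitrary: n)
  case (Suc r)
  have "A i (op_power A r (n - i) f) = 0" if "i \<le> n" for i
  proof (cases "i = 0")
    case False
    with Suc.prems that have "n - i < r" by auto
    with Suc.IH show ?thesis by (auto simp: module_hom.zero[OF linear])
  qed (simp add: zero_coeff)
  then show ?case by (simp add: op_power_Suc)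
qed simp

text \<open>The coefficient of \<open>s\<^sup>n\<close> in \<open>s (A\<^sup>r\<^sup>+\<^sup>1)' = (r + 1) s A' A\<^sup>r\<close>.\<close>

lemma op_power_Suc_derivative:
  "of_nat n * op_power A (Suc r) n f =
     of_nat (Suc r) * (\<Sum>k\<le>n. of_nat k * A k (op_power A r (n - k) f))"
proof (induction r arbitrary: n)
  case 0
  have "op_power A (Suc 0) n f = A n f" for n
    unfolding op_power_Suc
    by (subst sum.remove[of _ n])
       (auto simp: op_power_0 op_one_def module_hom.zero[OF linear] intro!: sum.neutral)
  moreover have "(\<Sum>k\<le>n. of_nat k * A k (op_power A 0 (n - k) f)) = of_nat n * A n f"
    by (subst sum.remove[of _ n])
       (auto simp: op_power_0 op_one_def module_hom.zero[OF linear] intro!: sum.neutral)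
  ultimately show ?case by simp
next
  case (Suc r)
  let ?P = "\<lambda>r n. op_power A r n f"
  define T where "T = (\<Sum>k\<le>n. of_nat k * A k (?P (Suc r) (n - k)))"
  have "of_nat n * ?P (Suc (Suc r)) n = (\<Sum>i\<le>n. of_nat n * A i (?P (Suc r) (n - i)))"
    by (simp only: op_power_Suc[of "Suc r"] sum_distrib_left)
  \<comment> \<open>Leibniz rule: writing n = i + (n - i), the derivative falls either on the first
    factor, which gives \<open>T\<close>, or on the remaining power, where the induction hypothesis
    applies.\<close>
  also have "\<dots> = (\<Sum>i\<le>n. of_nat i * A i (?P (Suc r) (n - i))
      + A i (of_nat (n - i) * ?P (Suc r) (n - i)))"
    by (intro sum.cong) (auto simp: linear_op_of_nat[OF linear] of_nat_diff
        module_hom.diff[OF linear] algebra_simps)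
  also have "\<dots> = T + (\<Sum>i\<le>n. A i (of_nat (Suc r) *
      (\<Sum>k\<le>n - i. of_nat k * A k (?P r (n - i - k)))))"
    unfolding T_def by (simp only: sum.distrib Suc)
  also have "(\<Sum>i\<le>n. A i (of_nat (Suc r) * (\<Sum>k\<le>n - i. of_nat k * A k (?P r (n - i - k)))))
     = of_nat (Suc r) * (\<Sum>i\<le>n. \<Sum>k\<le>n - i. of_nat k * A i (A k (?P r (n - i - k))))"
    by (simp only: linear_op_of_nat[OF linear] module_hom.sum[OF linear] sum_distrib_left)
  also have "(\<Sum>i\<le>n. \<Sum>k\<le>n - i. of_nat k * A i (A k (?P r (n - i - k))))
     = (\<Sum>k\<le>n. \<Sum>i\<le>n - k. of_nat k * A i (A k (?P r (n - i - k))))"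
    by (rule sum_triangle_swap)
  \<comment> \<open>Commutativity brings A_k to the front. The inner sum is then a coefficient of
    the power r + 1, so this half contributes r + 1 further copies of \<open>T\<close>.\<close>
  also have "\<dots> = (\<Sum>k\<le>n. of_nat k * A k (\<Sum>i\<le>n - k. A i (?P r (n - k - i))))"
    by (intro sum.cong refl)
      (simp add: module_hom.sum[OF linear] sum_distrib_left commute[of _ k for k] add.commute)
  also have "\<dots> = T"
    unfolding T_def by (simp only: op_power_Suc)
  finally show ?case unfolding T_def by (simp add: algebra_simps)
qed

lemma op_exp_extend: "n \<le> N \<Longrightarrow> op_exp A n f = (\<Sum>r\<le>N. scalar (1 / fact r) * op_power A r n f)"
  unfolding op_exp_def by (rule sum.mono_neutral_left) (auto simp: op_power_eq_0)

text \<open>The equation s (exp A)' = s A' exp A, compared at s^n. It follows termwise from the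
  power rule, since (r + 1) / (r + 1)! = 1 / r!.\<close>

lemma op_exp_derivative:
  "of_nat n * op_exp A n f = (\<Sum>k\<le>n. of_nat k * A k (op_exp A (n - k) f))"
proof (cases n)
  case (Suc N)
  \<comment> \<open>Here n > 0, so the power r = 0 has no coefficient at n and the summation can
    start at r + 1.\<close>
  have "of_nat n * op_exp A n f = (\<Sum>r\<le>N. of_nat n * (scalar (1 / fact (Suc r)) * op_power A (Suc r) n f))"
    using Suc by (simp add: op_exp_def sum.atMost_Suc_shift op_power_0 op_one_def sum_distrib_left
        algebra_simps del: sum.atMost_Suc)
  also have "\<dots> = (\<Sum>r\<le>N. scalar (1 / fact r) * (\<Sum>k\<le>n. of_nat k * A k (op_power A r (n - k) f)))"
  proof (intro sum.cong refl)
    fix r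
    have s: "scalar (1 / fact (Suc r)) * of_nat (Suc r) = scalar (1 / fact r)"
      unfolding scalar_of_nat[symmetric] scalar_mult[symmetric]
      by (simp add: field_simps del: of_nat_Suc)
    have "of_nat n * (scalar (1 / fact (Suc r)) * op_power A (Suc r) n f)
        = scalar (1 / fact (Suc r)) * (of_nat n * op_power A (Suc r) n f)"
      by (simp only: mult.left_commute)
    also have "\<dots> = scalar (1 / fact (Suc r)) * of_nat (Suc r)
        * (\<Sum>k\<le>n. of_nat k * A k (op_power A r (n - k) f))"
      by (simp only: op_power_Suc_derivative mult.assoc)
    finally show "of_nat n * (scalar (1 / fact (Suc r)) * op_power A (Suc r) n f)
        = scalar (1 / fact r) * (\<Sum>k\<le>n. of_nat k * A k (op_power A r (n - k) f))"
      by (simp only: s)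
  qed
  also have "\<dots> = (\<Sum>k\<le>n. \<Sum>r\<le>N. of_nat k * A k (scalar (1 / fact r) * op_power A r (n - k) f))"
    by (subst sum.swap)
      (simp only: sum_distrib_left module_hom.scale[OF linear] mult.left_commute)
  also have "\<dots> = (\<Sum>k\<le>n. of_nat k * A k (op_exp A (n - k) f))"
  proof (intro sum.cong refl)
    fix k
    show "(\<Sum>r\<le>N. of_nat k * A k (scalar (1 / fact r) * op_power A r (n - k) f))
        = of_nat k * A k (op_exp A (n - k) f)"
    \<comment> \<open>The truncation at N = n - 1 is long enough for every n - k with k > 0; for k =
      0 the factor k kills the term.\<close>
    proof (cases "k = 0")
      case False
      then have "n - k \<le> N" using Suc by simp
      then show ?thesis
        by (simp add: op_exp_extend[of "n - k" N] module_hom.sum[OF linear] sum_distrib_left)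
    qed simp
  qed
  finally show ?thesis .
qed simp

end

section \<open>Derivatives with respect to the power sums\<close>

lemma lookup_pderiv_powersum:
  "Poly_Mapping.lookup (pderiv_powersum k f) m =
     of_nat (Suc (Poly_Mapping.lookup m (k - 1))) *
     Poly_Mapping.lookup f (m + Poly_Mapping.single (k - 1) 1)"
proof -
  let ?e = "Poly_Mapping.single (k - 1) (1::nat)"
  let ?c = "of_nat (Suc (Poly_Mapping.lookup m (k - 1))) * Poly_Mapping.lookup f (m + ?e)"
  have "Poly_Mapping.lookup (pderiv_powersum k f) m =
      (\<Sum>m'\<in>Poly_Mapping.keys f. if m' = m + ?e then ?c else 0)"
    unfolding pderiv_powersum_def lookup_sum
  proof (intro sum.cong refl)
    fix m'
    show "Poly_Mapping.lookup (Poly_Mapping.single (m' - ?e)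
          (of_nat (Poly_Mapping.lookup m' (k - 1)) * Poly_Mapping.lookup f m')) m =
        (if m' = m + ?e then ?c else 0)"
    \<comment> \<open>Subtraction of exponents is truncated. If p_k does not occur in m', the
      coefficient vanishes anyway; otherwise the subtraction can be undone, and only m' = m + e
      contributes.\<close>
    proof (cases "Poly_Mapping.lookup m' (k - 1) = 0")
      case True
      then have "m' \<noteq> m + ?e" by (auto simp: lookup_add)
      with True show ?thesis by simp
    next
      case False
      then have "m' - ?e + ?e = m'"
        by (intro poly_mapping_eqI) (auto simp: lookup_add lookup_minus lookup_single when_def)
      then have "m' - ?e = m \<longleftrightarrow> m' = m + ?e"
        by (metis add_diff_cancel_right')
      then show ?thesis by (auto simp: lookup_single when_def lookup_add)
    qed
  qed
  also have "\<dots> = ?c"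
    by (simp add: in_keys_iff)
  finally show ?thesis .
qed

lemma linear_op_pderiv: "linear_op (pderiv_powersum k)"
  by (rule linear_opI; rule poly_mapping_eqI)
    (simp_all only: lookup_pderiv_powersum lookup_add lookup_scalar_mult distrib_left mult.left_commute)

lemma pderiv_commute:
  "pderiv_powersum i (pderiv_powersum j f) = pderiv_powersum j (pderiv_powersum i f)"
  by (cases "i - 1 = j - 1"; rule poly_mapping_eqI)
    (simp_all add: lookup_pderiv_powersum lookup_add lookup_single when_def add_ac)

lemma pderiv_single:
  "pderiv_powersum k (Poly_Mapping.single m c) =
     Poly_Mapping.single (m - Poly_Mapping.single (k - 1) 1)
       (of_nat (Poly_Mapping.lookup m (k - 1)) * c)"
  by (cases "c = 0") (simp_all add: pderiv_powersum_def)

text \<open>The Leibniz rule, checked on monomials. The lower bounds on i and k ensure that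
  different power sums are different variables after the index shift by 1.\<close>

lemma pderiv_powersum_mult:
  assumes "k \<ge> 1" "i \<ge> 1"
  shows "pderiv_powersum k (powersum i * f) =
    powersum i * pderiv_powersum k f + (if i = k then f else 0)"
proof (induction f rule: symfun_induct)
  case (single m c)
  let ?e = "\<lambda>i. Poly_Mapping.single (i - 1) (1::nat)"
  show ?case
  proof (cases "i = k")
    case True
    show ?thesis
    proof (cases "Poly_Mapping.lookup m (k - 1) = 0")
      case False
      then have "?e k + (m - ?e k) = m"
        by (intro poly_mapping_eqI) (auto simp: lookup_add lookup_minus lookup_single when_def)
      with True show ?thesis
        by (simp add: powersum_def mult_single pderiv_single lookup_add
            algebra_simps flip: single_add)
    qed (use True in \<open>simp add: powersum_def mult_single pderiv_single lookup_add\<close>)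
  next
    case False
    with assms have "i - 1 \<noteq> k - 1" by simp
    then have "?e i + m - ?e k = ?e i + (m - ?e k)"
      by (intro poly_mapping_eqI) (auto simp: lookup_add lookup_minus lookup_single when_def)
    with False \<open>i - 1 \<noteq> k - 1\<close> show ?thesis
      by (simp add: powersum_def mult_single pderiv_single lookup_add lookup_single when_def)
  qed
next
  case (add f g)
  then show ?case
    by (simp add: distrib_left module_hom.add[OF linear_op_pderiv])
qed

interpretation raising: commuting_series raising
proof (rule commuting_series.intro)
  show "linear_op (raising k)" for k
    by (rule linear_opI) (simp_all add: raising_def algebra_simps)
  show "raising i (raising j f) = raising j (raising i f)" for i j f
    by (simp add: raising_def mult_ac)
qed (simp add: raising_def)

interpretation lowering: commuting_series lowering
proof (rule commuting_series.intro)
  note [simp] = module_hom.zero[OF linear_op_pderiv] module_hom.neg[OF linear_op_pderiv]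
  show "linear_op (lowering k)" for k
    by (rule linear_opI) (simp_all add: lowering_def module_hom.add[OF linear_op_pderiv]
        module_hom.scale[OF linear_op_pderiv])
  show "lowering i (lowering j f) = lowering j (lowering i f)" for i j f
    by (simp add: lowering_def pderiv_commute[of i])
qed (simp add: lowering_def)

section \<open>Vertex operators\<close>

text \<open>Multiplication by the complete symmetric function h_n. Extending by 0 to negative
  indices removes boundary cases from the recursions.\<close>

definition hmult :: "int \<Rightarrow> symfun \<Rightarrow> symfun" where
  "hmult n f = (if n < 0 then 0 else op_exp raising (nat n) f)"

text \<open>Up to the sign (-1)^n, the adjoint of multiplication by the n-th elementary symmetric
  function for the Hall scalar product.\<close>

definition eskew :: "int \<Rightarrow> symfun \<Rightarrow> symfun" where
  "eskew n f = (if n < 0 then 0 else op_exp lowering (nat n) f)"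

lemma linear_op_zero: "linear_op (\<lambda>f. 0)"
  by (rule linear_opI) simp_all

lemma linear_op_hmult: "linear_op (hmult n)"
  using raising.linear_op_exp linear_op_zero by (cases "n < 0") (simp_all add: hmult_def[abs_def])

lemma linear_op_eskew: "linear_op (eskew n)"
  using lowering.linear_op_exp linear_op_zero by (cases "n < 0") (simp_all add: eskew_def[abs_def])

lemma hmult_commute: "hmult a (hmult b f) = hmult b (hmult a f)"
proof -
  have "op_exp raising i (raising k f) = raising k (op_exp raising i f)" for i k f
    by (rule raising.op_exp_commute[OF raising.linear raising.commute, symmetric])
  then have "op_exp raising i (op_exp raising j f) = op_exp raising j (op_exp raising i f)" for i j f
    by (intro raising.op_exp_commute raising.linear_op_exp)
  then show ?thesis
    by (simp add: hmult_def module_hom.zero[OF raising.linear_op_exp])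
qed

lemma eskew_commute: "eskew a (eskew b f) = eskew b (eskew a f)"
proof -
  have "op_exp lowering i (lowering k f) = lowering k (op_exp lowering i f)" for i k f
    by (rule lowering.op_exp_commute[OF lowering.linear lowering.commute, symmetric])
  then have "op_exp lowering i (op_exp lowering j f) = op_exp lowering j (op_exp lowering i f)" for i j f
    by (intro lowering.op_exp_commute lowering.linear_op_exp)
  then show ?thesis
    by (simp add: eskew_def module_hom.zero[OF lowering.linear_op_exp])
qed

section \<open>Newton recursions for the coefficients of the two exponentials\<close>

text \<open>Newton's identity, read off from the derivative of H(t). The free bound N lets
  recursions for different n be added over one summation range; the extra terms have negative index
  and vanish.\<close>

lemma hmult_derivative:
  assumes "N \<ge> n"
  shows "of_int n * hmult n f = (\<Sum>k=1..nat N. powersum k * hmult (n - int k) f)"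
proof (cases "n \<ge> 1")
  case True
  have "of_int n * hmult n f = of_nat (nat n) * op_exp raising (nat n) f"
    using True by (simp add: hmult_def)
  also have "\<dots> = (\<Sum>k\<le>nat n. of_nat k * raising k (op_exp raising (nat n - k) f))"
    by (rule raising.op_exp_derivative)
  also have "\<dots> = (\<Sum>k=1..nat n. of_nat k * raising k (op_exp raising (nat n - k) f))"
    by (rule sum.mono_neutral_right) auto
  also have "\<dots> = (\<Sum>k=1..nat n. powersum k * hmult (n - int k) f)"
  proof (intro sum.cong refl)
    fix k assume k: "k \<in> {1..nat n}"
    then have "nat (n - int k) = nat n - k" "\<not> n < int k" by auto
    moreover have "(of_nat k * scalar (1 / of_nat k) :: symfun) = 1"
      unfolding scalar_of_nat[symmetric] scalar_mult[symmetric] using k by (simp add: scalar_one)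
    ultimately show "of_nat k * raising k (op_exp raising (nat n - k) f)
        = powersum k * hmult (n - int k) f"
      using k by (simp add: raising_def hmult_def mult.assoc[symmetric])
  qed
  also have "\<dots> = (\<Sum>k=1..nat N. powersum k * hmult (n - int k) f)"
    using assms by (intro sum.mono_neutral_left) (auto simp: hmult_def)
  finally show ?thesis .
next
  case False
  then have "hmult (n - int k) f = 0" if "k \<ge> 1" for k
    using that by (simp add: hmult_def)
  moreover have "of_int n * hmult n f = 0"
    using False by (cases "n = 0") (simp_all add: hmult_def)
  ultimately show ?thesis by simp
qed

lemma eskew_derivative:
  assumes "N \<ge> n"
  shows "of_int n * eskew n f = - (\<Sum>k=1..nat N. of_nat k * pderiv_powersum k (eskew (n - int k) f))"
proof (cases "n \<ge> 1")
  case True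
  have "of_int n * eskew n f = of_nat (nat n) * op_exp lowering (nat n) f"
    using True by (simp add: eskew_def)
  also have "\<dots> = (\<Sum>k\<le>nat n. of_nat k * lowering k (op_exp lowering (nat n - k) f))"
    by (rule lowering.op_exp_derivative)
  also have "\<dots> = (\<Sum>k=1..nat n. of_nat k * lowering k (op_exp lowering (nat n - k) f))"
    by (rule sum.mono_neutral_right) auto
  also have "\<dots> = - (\<Sum>k=1..nat n. of_nat k * pderiv_powersum k (eskew (n - int k) f))"
    unfolding sum_negf[symmetric]
  proof (intro sum.cong refl)
    fix k assume k: "k \<in> {1..nat n}"
    then have "nat (n - int k) = nat n - k" "\<not> n < int k" by auto
    then show "of_nat k * lowering k (op_exp lowering (nat n - k) f)
        = - (of_nat k * pderiv_powersum k (eskew (n - int k) f))"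
      using k by (simp add: lowering_def eskew_def)
  qed
  also have "(\<Sum>k=1..nat n. of_nat k * pderiv_powersum k (eskew (n - int k) f))
      = (\<Sum>k=1..nat N. of_nat k * pderiv_powersum k (eskew (n - int k) f))"
    using assms
    by (intro sum.mono_neutral_left) (auto simp: eskew_def module_hom.zero[OF linear_op_pderiv])
  finally show ?thesis .
next
  case False
  then have "eskew (n - int k) f = 0" if "k \<ge> 1" for k
    using that by (simp add: eskew_def)
  moreover have "of_int n * eskew n f = 0"
    using False by (cases "n = 0") (simp_all add: eskew_def)
  ultimately show ?thesis by (simp add: module_hom.zero[OF linear_op_pderiv])
qed

lemma linear_op_of_int:
  assumes "linear_op F"
  shows "F (of_int n * f) = of_int n * F f"
  using linear_op_of_nat[OF assms] module_hom.neg[OF assms]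
  by (cases n rule: int_cases2) (simp_all)

section \<open>Commutation of the two exponentials\<close>

text \<open>Differentiating H(t) by p_k multiplies it by t^k / k; the factor k clears the
  denominator. The proof feeds Newton's identity into an induction on n.\<close>

lemma pderiv_hmult:
  assumes k: "k \<ge> 1"
  shows "of_nat k * pderiv_powersum k (hmult n f) =
    of_nat k * hmult n (pderiv_powersum k f) + hmult (n - int k) f"
proof (induction "nat n" arbitrary: n rule: less_induct)
  case less
  note d = module_hom.sum[OF linear_op_pderiv]
  consider "n < 0" | "n = 0" | "n \<ge> 1" by linarith
  then show ?case
  proof cases
    case 1
    with k show ?thesis by (simp add: hmult_def module_hom.zero[OF linear_op_pderiv])
  next
    case 2
    with k show ?thesis by (simp add: hmult_def raising.op_exp_0)
  next
    case 3
    let ?d = "pderiv_powersum k"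
    have "of_int n * (of_nat k * ?d (hmult n f)) = of_nat k * ?d (of_int n * hmult n f)"
      by (simp add: linear_op_of_int[OF linear_op_pderiv] mult_ac)
    also have "\<dots> = (\<Sum>i=1..nat n. of_nat k * ?d (powersum i * hmult (n - int i) f))"
      by (simp add: hmult_derivative[OF order_refl] d sum_distrib_left)
    also have "\<dots> = (\<Sum>i=1..nat n. powersum i * (of_nat k * ?d (hmult (n - int i) f))
        + (if i = k then of_nat k * hmult (n - int k) f else 0))"
      using k by (intro sum.cong refl) (auto simp: pderiv_powersum_mult algebra_simps)
    also have "\<dots> = (\<Sum>i=1..nat n. of_nat k * (powersum i * hmult (n - int i) (?d f))
        + powersum i * hmult (n - int k - int i) f
        + (if i = k then of_nat k * hmult (n - int k) f else 0))"
    proof (intro sum.cong refl)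
      fix i assume "i \<in> {1..nat n}"
      then have "nat (n - int i) < nat n" by auto
      from less[OF this] have "of_nat k * ?d (hmult (n - int i) f) =
          of_nat k * hmult (n - int i) (?d f) + hmult (n - int k - int i) f"
        by (simp add: algebra_simps)
      then show "powersum i * (of_nat k * ?d (hmult (n - int i) f))
          + (if i = k then of_nat k * hmult (n - int k) f else 0)
        = of_nat k * (powersum i * hmult (n - int i) (?d f))
          + powersum i * hmult (n - int k - int i) f
          + (if i = k then of_nat k * hmult (n - int k) f else 0)"
        by (simp add: distrib_left mult.left_commute)
    qed
    \<comment> \<open>Newton's identity folds the first two sums back, the second one for n - k with
      the larger bound n.\<close>
    also have "\<dots> = of_nat k * (of_int n * hmult n (?d f)) + of_int (n - int k) * hmult (n - int k) f
        + (\<Sum>i=1..nat n. if i = k then of_nat k * hmult (n - int k) f else 0)"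
      using hmult_derivative[of n n "?d f"] hmult_derivative[of "n - int k" n f]
      by (simp add: sum.distrib sum_distrib_left)
    \<comment> \<open>If k > n, the sum never meets i = k, but then
      \<open>hmult (n - int k) f\<close> is 0 as well. Together with the factor n - k above, the
      coefficient becomes n, which is cancelled at the end.\<close>
    also have "(\<Sum>i=1..nat n. if i = k then of_nat k * hmult (n - int k) f else 0)
        = of_nat k * hmult (n - int k) f"
      using k by (auto simp: hmult_def)
    finally have "of_int n * (of_nat k * ?d (hmult n f)) =
        of_int n * (of_nat k * hmult n (?d f) + hmult (n - int k) f)"
      by (simp add: algebra_simps)
    with 3 show ?thesis by simp
  qed
qed

text \<open>The coefficient form of E(s) H(t) = (1 - s t) H(t) E(s). The recursion for e_j reduces
  to smaller j, and moving the derivatives past h_n leaves correction terms that telescope.\<close>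

lemma eskew_hmult:
  "eskew j (hmult n f) = hmult n (eskew j f) - hmult (n - 1) (eskew (j - 1) f)"
proof (induction "nat j" arbitrary: j rule: less_induct)
  case less
  consider "j < 0" | "j = 0" | "j \<ge> 1" by linarith
  then show ?case
  proof cases
    case 1
    then show ?thesis by (simp add: eskew_def module_hom.zero[OF linear_op_hmult])
  next
    case 2
    then show ?thesis
      by (simp add: eskew_def lowering.op_exp_0 module_hom.zero[OF linear_op_hmult])
  next
    case 3
    let ?G = "\<lambda>k. hmult (n - int k) (eskew (j - int k) f)"
    let ?d = "\<lambda>k g. of_nat k * pderiv_powersum k g"
    have h: "hmult a (\<Sum>k=1..nat j. ?d k (eskew (b - int k) f)) = - of_int b * hmult a (eskew b f)"
      if "b \<le> j" for a b
    proof -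
      have "(\<Sum>k=1..nat j. ?d k (eskew (b - int k) f)) = - (of_int b * eskew b f)"
        by (simp only: eskew_derivative[OF that] minus_minus)
      then show ?thesis
        by (simp only: module_hom.neg[OF linear_op_hmult] linear_op_of_int[OF linear_op_hmult]
            mult_minus_left)
    qed
    have h': "hmult (n - 1) (\<Sum>k=1..nat j. ?d k (eskew (j - 1 - int k) f))
        = - of_int (j - 1) * hmult (n - 1) (eskew (j - 1) f)"
      by (rule h) simp
    have G1: "?G 1 = hmult (n - 1) (eskew (j - 1) f)"
      by simp
    have "of_int j * eskew j (hmult n f) = - (\<Sum>k=1..nat j. ?d k (eskew (j - int k) (hmult n f)))"
      by (rule eskew_derivative) simp
    also have "(\<Sum>k=1..nat j. ?d k (eskew (j - int k) (hmult n f)))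
      = (\<Sum>k=1..nat j. ?d k (hmult n (eskew (j - int k) f))
          - ?d k (hmult (n - 1) (eskew (j - 1 - int k) f)))"
    proof (intro sum.cong refl)
      fix k assume "k \<in> {1..nat j}"
      then have "nat (j - int k) < nat j" by auto
      moreover have "j - int k - 1 = j - 1 - int k" by simp
      ultimately show "?d k (eskew (j - int k) (hmult n f)) = ?d k (hmult n (eskew (j - int k) f))
          - ?d k (hmult (n - 1) (eskew (j - 1 - int k) f))"
        by (simp only: less module_hom.diff[OF linear_op_pderiv] right_diff_distrib)
    qed
    \<comment> \<open>Each of the two products yields one correction term by
      \<open>pderiv_hmult\<close>; the second is the first with k + 1 in place of k.\<close>
    also have "\<dots> = (\<Sum>k=1..nat j. hmult n (?d k (eskew (j - int k) f))
        - hmult (n - 1) (?d k (eskew (j - 1 - int k) f)) + (?G k - ?G (Suc k)))"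
    proof (intro sum.cong refl)
      fix k assume k: "k \<in> {1..nat j}"
      have d: "?d k (hmult a g) = hmult a (?d k g) + hmult (a - int k) g" for a g
        using k by (simp only: pderiv_hmult linear_op_of_nat[OF linear_op_hmult] atLeastAtMost_iff)
      have "n - 1 - int k = n - int (Suc k)" "j - 1 - int k = j - int (Suc k)" by simp_all
      then show "?d k (hmult n (eskew (j - int k) f)) - ?d k (hmult (n - 1) (eskew (j - 1 - int k) f))
          = hmult n (?d k (eskew (j - int k) f)) - hmult (n - 1) (?d k (eskew (j - 1 - int k) f))
            + (?G k - ?G (Suc k))"
        by (simp only: d) (simp only: add_diff_add)
    qed
    also have "\<dots> = hmult n (\<Sum>k=1..nat j. ?d k (eskew (j - int k) f))
        - hmult (n - 1) (\<Sum>k=1..nat j. ?d k (eskew (j - 1 - int k) f))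
        + (\<Sum>k=1..nat j. ?G k - ?G (Suc k))"
      by (simp only: sum.distrib sum_subtractf module_hom.sum[OF linear_op_hmult])
    also have "(\<Sum>k=1..nat j. ?G k - ?G (Suc k)) = ?G 1 - ?G (Suc (nat j))"
      using 3 sum_Suc_diff'[of 1 "Suc (nat j)" "\<lambda>k. - ?G k"]
      by (simp add: atLeastLessThanSuc_atLeastAtMost)
    \<comment> \<open>The index of \<open>eskew\<close> is j - (j + 1) = -1.\<close>
    also have "?G (Suc (nat j)) = 0"
      using 3 by (simp add: eskew_def module_hom.zero[OF linear_op_hmult])
    \<comment> \<open>The multiples -(j - 1) from \<open>h'\<close> and -1 from the telescoping sum
      combine to -j, so the common factor j can be cancelled.\<close>
    finally have "of_int j * eskew j (hmult n f)
        = of_int j * (hmult n (eskew j f) - hmult (n - 1) (eskew (j - 1) f))"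
      by (simp only: h[OF order_refl] h' G1) (simp add: algebra_simps)
    with 3 show ?thesis by simp
  qed
qed

section \<open>Bernstein operators and their exchange relation\<close>

lemma eskew_eventually_0: "\<exists>N. \<forall>j>N. eskew (int j) f = 0"
proof -
  have "finite {j. eskew (int j) f \<noteq> 0}"
    using finite_op_exp_lowering[of f] by (simp add: eskew_def)
  then obtain N where "\<forall>j\<in>{j. eskew (int j) f \<noteq> 0}. j \<le> N"
    using finite_nat_set_iff_bounded_le by blast
  then have "eskew (int j) f = 0" if "j > N" for j
    using that by fastforce
  then show ?thesis by blast
qed

text \<open>Replaces the summation set, which depends on f, by any sufficiently long interval, so
  that sums for different arguments can be combined.\<close>

lemma bernstein_eq_sum:
  assumes "\<And>j. j > N \<Longrightarrow> eskew (int j) f = 0"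
  shows "bernstein n f = (\<Sum>j\<le>N. hmult (n + int j) (eskew (int j) f))"
proof -
  have "bernstein n f = (\<Sum>j | 0 \<le> n + int j \<and> op_exp lowering j f \<noteq> 0.
      hmult (n + int j) (eskew (int j) f))"
    unfolding bernstein_def by (intro sum.cong) (auto simp: hmult_def eskew_def)
  also have "\<dots> = (\<Sum>j\<le>N. hmult (n + int j) (eskew (int j) f))"
  proof (intro sum.mono_neutral_left ballI)
    show "{j. 0 \<le> n + int j \<and> op_exp lowering j f \<noteq> 0} \<subseteq> {..N}"
    proof
      fix j assume "j \<in> {j. 0 \<le> n + int j \<and> op_exp lowering j f \<noteq> 0}"
      with assms[of j] show "j \<in> {..N}" by (cases "j \<le> N") (simp_all add: eskew_def)
    qed
    show "hmult (n + int i) (eskew (int i) f) = 0"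
      if "i \<in> {..N} - {j. 0 \<le> n + int j \<and> op_exp lowering j f \<noteq> 0}" for i
      using that module_hom.zero[OF raising.linear_op_exp]
      by (cases "n + int i < 0") (simp_all add: hmult_def eskew_def)
  qed simp
  finally show ?thesis .
qed

lemma linear_op_bernstein: "linear_op (bernstein n)"
proof (rule linear_opI)
  fix f g
  obtain M N where "\<forall>j>M. eskew (int j) f = 0" "\<forall>j>N. eskew (int j) g = 0"
    using eskew_eventually_0 by meson
  then have "bernstein n h = (\<Sum>j\<le>max M N. hmult (n + int j) (eskew (int j) h))"
    if "h \<in> {f, g, f + g}" for h
    using that by (intro bernstein_eq_sum) (auto simp: module_hom.add[OF linear_op_eskew])
  then show "bernstein n (f + g) = bernstein n f + bernstein n g"
    by (simp add: module_hom.add[OF linear_op_eskew] module_hom.add[OF linear_op_hmult] sum.distrib)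
next
  fix c f
  obtain N where "\<forall>j>N. eskew (int j) f = 0"
    using eskew_eventually_0 by meson
  then have "bernstein n h = (\<Sum>j\<le>N. hmult (n + int j) (eskew (int j) h))"
    if "h \<in> {f, scalar c * f}" for h
    using that by (intro bernstein_eq_sum) (auto simp: module_hom.scale[OF linear_op_eskew])
  then show "bernstein n (scalar c * f) = scalar c * bernstein n f"
    by (simp add: module_hom.scale[OF linear_op_eskew] module_hom.scale[OF linear_op_hmult]
        sum_distrib_left)
qed

text \<open>Replacing (a, b) by (b - 1, a + 1) in S(a, b) - S(a + 1, b - 1) gives S(b - 1, a + 1) -
  S(b, a), which is the negative because S is symmetric.\<close>

lemma bernstein_commute:
  "bernstein a (bernstein b f) = - bernstein (b - 1) (bernstein (a + 1) f)"
proof -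
  obtain N where N: "\<And>j. j > N \<Longrightarrow> eskew (int j) f = 0"
    using eskew_eventually_0 by meson
  define S where "S = (\<lambda>a b. \<Sum>i\<le>N. \<Sum>j\<le>N.
    hmult (a + int i) (hmult (b + int j) (eskew (int i) (eskew (int j) f))))"
  have S_commute: "S a b = S b a" for a b
    unfolding S_def by (subst sum.swap) (simp only: hmult_commute[of "a + _"] eskew_commute)
  have eskew2: "eskew (int i) (eskew j f) = 0" if "i > N" for i j
    using N[OF that] by (simp add: eskew_commute[of _ j] module_hom.zero[OF linear_op_eskew])
  have expand: "bernstein a (bernstein b f) = S a b - S (a + 1) (b - 1)" for a b
  proof -
    have B: "bernstein b f = (\<Sum>j\<le>Suc N. hmult (b + int j) (eskew (int j) f))"
      by (rule bernstein_eq_sum) (simp add: N)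
    have comm: "eskew (int i) (hmult c (eskew (int j) f)) = hmult c (eskew (int i) (eskew (int j) f))
        - hmult (c - 1) (eskew (int i - 1) (eskew (int j) f))" for i j c
      by (rule eskew_hmult)
    let ?T = "\<lambda>i j. hmult (a + int i) (hmult (b + int j) (eskew (int i) (eskew (int j) f)))"
    let ?T' = "\<lambda>i j. hmult (a + int i) (hmult (b - 1 + int j) (eskew (int i - 1) (eskew (int j) f)))"
    have "eskew (int i) (bernstein b f) = 0" if "i > Suc N" for i
    proof -
      from that obtain i' where i': "i = Suc i'" "i' > N" by (cases i) auto
      then have "int i - 1 = int i'" by simp
      with i' eskew2[of i'] eskew2[of i] show ?thesis
        by (simp only: B module_hom.sum[OF linear_op_eskew] comm module_hom.zero[OF linear_op_hmult])
          simp
    qed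
    \<comment> \<open>The bound is N + 1 rather than N: moving e_i past h also produces e_(i-1),
      which may survive at i = N + 1.\<close>
    then have "bernstein a (bernstein b f)
        = (\<Sum>i\<le>Suc N. hmult (a + int i) (eskew (int i) (bernstein b f)))"
      by (rule bernstein_eq_sum)
    also have "\<dots> = (\<Sum>i\<le>Suc N. \<Sum>j\<le>Suc N. ?T i j) - (\<Sum>i\<le>Suc N. \<Sum>j\<le>Suc N. ?T' i j)"
      by (simp only: B module_hom.sum[OF linear_op_eskew] comm module_hom.sum[OF linear_op_hmult]
            module_hom.diff[OF linear_op_hmult] sum_subtractf)
        (simp only: diff_add_eq)
    also have "(\<Sum>i\<le>Suc N. \<Sum>j\<le>Suc N. ?T i j) = S a b"
    proof -
      have "?T (Suc N) j = 0" "?T j (Suc N) = 0" for j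
        by (simp_all only: N[OF lessI] eskew2[OF lessI] module_hom.zero[OF linear_op_hmult]
            module_hom.zero[OF linear_op_eskew])
      then show ?thesis by (simp add: S_def del: of_nat_Suc)
    qed
    also have "(\<Sum>i\<le>Suc N. \<Sum>j\<le>Suc N. ?T' i j) = S (a + 1) (b - 1)"
    proof -
      have "(\<Sum>i\<le>Suc N. \<Sum>j\<le>Suc N. ?T' i j) = (\<Sum>i\<le>Suc N. \<Sum>j\<le>N. ?T' i j)"
        by (simp add: N[of "Suc N", simplified] module_hom.zero[OF linear_op_hmult]
            module_hom.zero[OF linear_op_eskew])
      \<comment> \<open>The term i = 0 contains e_(-1) = 0. After the index shift, a + (i + 1) is
        read as (a + 1) + i.\<close>
      also have "\<dots> = (\<Sum>i\<le>N. \<Sum>j\<le>N. ?T' (Suc i) j)"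
        by (subst sum.atMost_Suc_shift)
          (simp add: eskew_def[of "- 1"] module_hom.zero[OF linear_op_hmult])
      also have "\<dots> = S (a + 1) (b - 1)"
        unfolding S_def by (intro sum.cong) (simp_all add: algebra_simps)
      finally show ?thesis .
    qed
    finally show ?thesis .
  qed
  show ?thesis
    unfolding expand by (simp add: S_commute[of "b - 1"] S_commute[of b])
qed

text \<open>For b = a + 1 the exchange relation equates the product with its own negative.\<close>

lemma bernstein_Suc_eq_0: "bernstein a (bernstein (a + 1) f) = 0"
proof -
  have "bernstein a (bernstein (a + 1) f) = - bernstein a (bernstein (a + 1) f)"
    using bernstein_commute[of a "a + 1" f] by simp
  then have "2 * bernstein a (bernstein (a + 1) f) = 0"
    by (metis add.right_inverse mult_2)
  then show ?thesis by simp
qed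

lemma linear_op_bernstein_prod: "linear_op (bernstein_prod \<mu>)"
proof (induction \<mu>)
  case Nil
  show ?case by (rule linear_opI) (simp_all add: bernstein_prod_def)
next
  case (Cons a \<mu>)
  then have "linear_op (bernstein (int a) \<circ> bernstein_prod \<mu>)"
    by (rule module_hom_compose) (rule linear_op_bernstein)
  moreover have "bernstein_prod (a # \<mu>) = bernstein (int a) \<circ> bernstein_prod \<mu>"
    by (simp add: bernstein_prod_def fun_eq_iff)
  ultimately show ?case by (simp only:)
qed

lemma bernstein_prod_Cons:
  "bernstein_prod (a # \<mu>) f = bernstein (int a) (bernstein_prod \<mu> f)"
  by (simp add: bernstein_prod_def)

lemma bernstein_prod_append:
  "bernstein_prod (\<mu> @ \<nu>) f = bernstein_prod \<mu> (bernstein_prod \<nu> f)"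
  by (induction \<mu>) (simp_all add: bernstein_prod_Cons, simp add: bernstein_prod_def)

lemma linear_op_minus_one_power:
  assumes "linear_op F"
  shows "F ((- 1) ^ r * f) = (- 1) ^ r * F f"
  using linear_op_of_int[OF assms, of "(- 1) ^ r"] by simp

section \<open>Codes and straightening\<close>

text \<open>The value 0 for the empty composition represents the negative y-axis below the diagram.
  The initial run of R then becomes an ordinary \<open>hstep\<close>, and codes obey one uniform
  recursion.\<close>

definition first_row :: "nat list \<Rightarrow> nat" where
  "first_row \<mu> = (case \<mu> of [] \<Rightarrow> 0 | a # _ \<Rightarrow> a)"

lemma first_row_simps [simp]: "first_row [] = 0" "first_row (a # \<mu>) = a"
  by (simp_all add: first_row_def)

lemma code_middle_Cons: "code_middle (a # \<mu>) = code_middle \<mu> @ hstep (first_row \<mu>) a @ [U]"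
  by (cases \<mu>) (simp_all add: hstep_def)

lemma rev_code_middle_Cons:
  "rev (code_middle (a # \<mu>)) = U # hstep (first_row \<mu>) a @ rev (code_middle \<mu>)"
  by (simp add: code_middle_Cons hstep_def)

lemma U_notin_hstep: "U \<notin> set (hstep a b)"
  by (simp add: hstep_def)

text \<open>Reaching column \<open>first_row\<close> from the y-axis takes at least that many
  horizontal letters. This will place \<beta>_k inside the finite part of the code.\<close>

lemma first_row_le_length_code: "first_row \<mu> \<le> length (code_middle \<mu>)"
  by (induction \<mu>) (auto simp: code_middle_Cons hstep_def)

text \<open>A letter L appears exactly where a row is shorter than the row below it.\<close>

lemma sorted_if_no_L: "L \<notin> set (code_middle \<mu>) \<Longrightarrow> sorted_wrt (\<ge>) \<mu>"
proof (induction \<mu>)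
  case (Cons a \<mu>)
  then have "first_row \<mu> \<le> a" "sorted_wrt (\<ge>) \<mu>"
    by (auto simp: code_middle_Cons hstep_def split: if_splits)
  then show ?case by (cases \<mu>) auto
qed simp

text \<open>
  Moving \<open>B\<^sub>a\<close> to the right past \<open>B\<^sub>c\<close> turns it into \<open>B\<^sub>a\<^sub>+\<^sub>1\<close> and shortens the passed row by one box. In
  the code of \<open>\<kappa>\<close>, read from right to left, the vertical step of the \<open>i\<close>-th row has index
  \<open>i + \<kappa>\<^sub>1 - \<kappa>\<^sub>i\<close>. This index is \<open>k = \<kappa>\<^sub>1 - a\<close> exactly when \<open>\<kappa>\<^sub>i = a + i\<close>, that is, when the moving
  operator, by then \<open>B\<^sub>a\<^sub>+\<^sub>i\<^sub>-\<^sub>1\<close>, meets \<open>B\<^sub>a\<^sub>+\<^sub>i\<close> and the product vanishes.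
\<close>

lemma bernstein_straighten:
  assumes "sorted_wrt (\<ge>) \<kappa>" "\<forall>x\<in>set \<kappa>. 0 < x" "0 < a" "k \<ge> 1" "first_row \<kappa> = a + k"
  shows "(rev (code_middle \<kappa>) ! (k - 1) = U \<longrightarrow> (\<forall>f. bernstein_prod (a # \<kappa>) f = 0)) \<and>
    (rev (code_middle \<kappa>) ! (k - 1) = R \<longrightarrow>
      (\<exists>\<nu>. length \<nu> = Suc (length \<kappa>) \<and> (\<forall>x\<in>set \<nu>. 0 < x) \<and> sum_list \<nu> = a + sum_list \<kappa> \<and>
        first_row \<nu> = first_row \<kappa> - 1 \<and>
        rev (code_middle \<nu>) = (rev (code_middle \<kappa>))[k - 1 := U] \<and>
        (\<forall>f. bernstein_prod (a # \<kappa>) f =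
          (- 1) ^ length (filter ((=) U) (take (k - 1) (rev (code_middle \<kappa>)))) * bernstein_prod \<nu> f)))"
  using assms
proof (induction \<kappa> arbitrary: a k)
  case Nil
  then show ?case by simp
next
  case (Cons c \<kappa>)
  define b where "b = first_row \<kappa>"
  define rc where "rc = rev (code_middle \<kappa>)"
  have c: "c = a + k" using Cons.prems by simp
  have "b \<le> c" using Cons.prems(1) by (cases \<kappa>) (auto simp: b_def)
  then have rc_Cons: "rev (code_middle (c # \<kappa>)) = U # replicate (c - b) R @ rc"
    by (simp add: rev_code_middle_Cons b_def rc_def hstep_def)
  have swap: "bernstein_prod (a # c # \<kappa>) f = - bernstein_prod ((c - 1) # Suc a # \<kappa>) f" for f
    using bernstein_commute[of "int a" "int c"] c Cons.prems(4)
    by (simp add: bernstein_prod_Cons of_nat_diff add.commute)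
  \<comment> \<open>For k = 1 the rows are a, a + 1 and the product vanishes. Otherwise the
    operators are exchanged, and B_(a+1) either rests on a row b of length at most a + 1 or has to
    move on.\<close>
  consider "k = 1" | "k \<ge> 2" "b \<le> Suc a" | "k \<ge> 2" "Suc a < b"
    using Cons.prems(4) by linarith
  then show ?case
  proof cases
    case 1
    then have "bernstein_prod (a # c # \<kappa>) f = 0" for f
      using bernstein_Suc_eq_0[of "int a"] c by (simp add: bernstein_prod_Cons add.commute)
    with 1 show ?thesis by (simp add: rc_Cons)
  next
    case 2
    let ?\<nu> = "(c - 1) # Suc a # \<kappa>"
    obtain k' where k': "k = Suc (Suc k')" using 2(1) by (metis add_2_eq_Suc le_Suc_ex)
    \<comment> \<open>After the exchange the rows are c - 1, a + 1, b. The old run of c - b letters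
      R splits into k' = k - 2 letters, the R that becomes U, and the run between a + 1 and
      b.\<close>
    have cb: "c - b = Suc k' + (Suc a - b)" using 2 c k' by simp
    have split: "replicate (c - b) R = replicate k' R @ R # replicate (Suc a - b) R"
      unfolding cb by (simp add: replicate_add replicate_app_Cons_same)
    have "rev (code_middle ?\<nu>) = U # replicate k' R @ U # replicate (Suc a - b) R @ rc"
      using 2 c k' by (simp add: rev_code_middle_Cons b_def rc_def hstep_def)
    moreover have "(rev (code_middle (c # \<kappa>))) ! (k - 1) = R"
      "(rev (code_middle (c # \<kappa>)))[k - 1 := U] = U # replicate k' R @ U # replicate (Suc a - b) R @ rc"
      "filter ((=) U) (take (k - 1) (rev (code_middle (c # \<kappa>)))) = [U]"
      by (simp_all add: rc_Cons split k' nth_append list_update_append)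
    ultimately show ?thesis
      using Cons.prems 2 c swap by (intro conjI impI exI[of _ ?\<nu>]) auto
  next
    case 3
    \<comment> \<open>The moving operator is now B_(a+1) and the next row has length (a + 1) +
      k'.\<close>
    define k' where "k' = b - Suc a"
    have IH: "(rc ! (k' - 1) = U \<longrightarrow> (\<forall>f. bernstein_prod (Suc a # \<kappa>) f = 0)) \<and>
      (rc ! (k' - 1) = R \<longrightarrow>
        (\<exists>\<nu>. length \<nu> = Suc (length \<kappa>) \<and> (\<forall>x\<in>set \<nu>. 0 < x) \<and> sum_list \<nu> = Suc a + sum_list \<kappa> \<and>
          first_row \<nu> = b - 1 \<and> rev (code_middle \<nu>) = rc[k' - 1 := U] \<and>
          (\<forall>f. bernstein_prod (Suc a # \<kappa>) f =
            (- 1) ^ length (filter ((=) U) (take (k' - 1) rc)) * bernstein_prod \<nu> f)))"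
      unfolding rc_def b_def using Cons.prems 3
      by (intro Cons.IH) (auto simp: k'_def b_def)
    have k: "k - 1 = Suc (c - b + (k' - 1))" using 3 c \<open>b \<le> c\<close> by (simp add: k'_def)
    have nth: "rev (code_middle (c # \<kappa>)) ! (k - 1) = rc ! (k' - 1)"
      unfolding rc_Cons k by (simp add: nth_append)
    have upd: "(rev (code_middle (c # \<kappa>)))[k - 1 := U] = U # replicate (c - b) R @ rc[k' - 1 := U]"
      unfolding rc_Cons k by (simp add: list_update_append)
    \<comment> \<open>The leading U of row c is the one new letter counted, and it matches the sign
      of the exchange.\<close>
    have count: "length (filter ((=) U) (take (k - 1) (rev (code_middle (c # \<kappa>)))))
        = Suc (length (filter ((=) U) (take (k' - 1) rc)))"
      unfolding rc_Cons k by simp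
    show ?thesis
    proof (intro conjI impI)
      assume "rev (code_middle (c # \<kappa>)) ! (k - 1) = U"
      then show "\<forall>f. bernstein_prod (a # c # \<kappa>) f = 0"
        using IH nth swap module_hom.zero[OF linear_op_bernstein]
        by (simp add: bernstein_prod_Cons)
    next
      assume "rev (code_middle (c # \<kappa>)) ! (k - 1) = R"
      then obtain \<nu> where \<nu>: "length \<nu> = Suc (length \<kappa>)" "\<forall>x\<in>set \<nu>. 0 < x"
        "sum_list \<nu> = Suc a + sum_list \<kappa>" "first_row \<nu> = b - 1"
        "rev (code_middle \<nu>) = rc[k' - 1 := U]"
        "\<And>f. bernstein_prod (Suc a # \<kappa>) f =
            (- 1) ^ length (filter ((=) U) (take (k' - 1) rc)) * bernstein_prod \<nu> f"
        using IH nth by auto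
      have "bernstein_prod (a # c # \<kappa>) f =
          (- 1) ^ Suc (length (filter ((=) U) (take (k' - 1) rc))) * bernstein_prod ((c - 1) # \<nu>) f" for f
        using swap[of f] \<nu>(6) linear_op_minus_one_power[OF linear_op_bernstein]
        by (simp add: bernstein_prod_Cons)
      \<comment> \<open>Row c and the first row b below it both lose one box, so the run between
        them keeps its length c - b.\<close>
      moreover have "rev (code_middle ((c - 1) # \<nu>)) = U # replicate (c - b) R @ rc[k' - 1 := U]"
        using \<nu>(4,5) 3 \<open>b \<le> c\<close> by (simp add: rev_code_middle_Cons hstep_def)
      ultimately show "\<exists>\<nu>. length \<nu> = Suc (length (c # \<kappa>)) \<and> (\<forall>x\<in>set \<nu>. 0 < x) \<and>
          sum_list \<nu> = a + sum_list (c # \<kappa>) \<and> first_row \<nu> = first_row (c # \<kappa>) - 1 \<and>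
          rev (code_middle \<nu>) = (rev (code_middle (c # \<kappa>)))[k - 1 := U] \<and>
          (\<forall>f. bernstein_prod (a # c # \<kappa>) f =
            (- 1) ^ length (filter ((=) U) (take (k - 1) (rev (code_middle (c # \<kappa>)))))
              * bernstein_prod \<nu> f)"
        unfolding upd count using \<nu> Cons.prems 3 c
        by (intro exI[of _ "(c - 1) # \<nu>"]) auto
    qed
  qed
qed

section \<open>Words\<close>

text \<open>The letters contributed by the upper rows. They depend on the lower rows only through
  the length x of the row just beneath, so the lower rows can be exchanged separately.\<close>

fun code_above :: "nat list \<Rightarrow> nat \<Rightarrow> letter list" where
  "code_above [] x = []"
| "code_above (a # \<mu>) x = code_above \<mu> x @ hstep (first_row (\<mu> @ [x])) a @ [U]"

lemma code_middle_append: "code_middle (\<mu> @ \<nu>) = code_middle \<nu> @ code_above \<mu> (first_row \<nu>)"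
proof (induction \<mu>)
  case (Cons a \<mu>)
  have "first_row (\<mu> @ \<nu>) = first_row (\<mu> @ [first_row \<nu>])"
    by (cases \<mu>) auto
  with Cons show ?case by (simp add: code_middle_Cons)
qed simp

lemma code_above_snoc: "code_above (\<mu> @ [b]) x = hstep x b @ U # code_above \<mu> b"
proof (induction \<mu>)
  case (Cons a \<mu>)
  have "first_row (\<mu> @ [b, x]) = first_row (\<mu> @ [b])"
    by (cases \<mu>) auto
  with Cons show ?case by simp
qed simp

lemma last_code_middle: "\<mu> \<noteq> [] \<Longrightarrow> last (code_middle \<mu>) = U"
  by (cases \<mu>) (simp_all add: code_middle_Cons)

lemma replicate_append_eq_cancel:
  assumes "replicate m x @ xs = replicate n x @ ys"
    and "xs = [] \<or> hd xs \<noteq> x" "ys = [] \<or> hd ys \<noteq> x"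
  shows "m = n \<and> xs = ys"
  using assms
proof (induction m arbitrary: n)
  case 0
  then show ?case by (cases n; cases xs) auto
next
  case (Suc m)
  then show ?case by (cases n; cases ys) auto
qed

section \<open>Locating the block L^k U in a code\<close>

text \<open>Since the block is not preceded by a horizontal letter, it is the whole horizontal step
  and vertical step of one row. Induction from the top row downwards finds that row.\<close>

lemma code_middle_split:
  assumes "code_middle \<mu> = xs @ replicate k L @ U # ys" "k \<ge> 1" "xs = [] \<or> last xs = U"
  shows "\<exists>\<mu>' a \<kappa>. \<mu> = \<mu>' @ a # \<kappa> \<and> xs = code_middle \<kappa> \<and> first_row \<kappa> = a + k \<and> ys = code_above \<mu>' a"
  using assms(1)
proof (induction \<mu> arbitrary: ys)
  case Nil
  then show ?case by simp
next
  case (Cons b \<mu>)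
  let ?h = "hstep (first_row \<mu>) b"
  have eq: "code_middle \<mu> @ ?h @ [U] = xs @ replicate k L @ U # ys"
    using Cons.prems by (simp add: code_middle_Cons)
  show ?case
  proof (cases ys rule: rev_cases)
    case Nil
    with eq have eq: "code_middle \<mu> @ ?h = xs @ replicate k L" by simp
    \<comment> \<open>Reading backwards turns both final runs into initial runs, whose lengths can
      be compared.\<close>
    have "rev (code_middle \<mu> @ ?h) = ?h @ rev (code_middle \<mu>)"
      by (simp add: hstep_def)
    then have rev_eq: "?h @ rev (code_middle \<mu>) = replicate k L @ rev xs"
      unfolding eq by simp
    have hd: "rev (code_middle \<mu>) = [] \<or> hd (rev (code_middle \<mu>)) = U"
      using last_code_middle[of \<mu>] by (cases "\<mu> = []") (auto simp: hd_rev)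
    have "\<not> first_row \<mu> \<le> b"
    proof
      assume "first_row \<mu> \<le> b"
      then have "hd (?h @ rev (code_middle \<mu>)) \<noteq> L \<or> ?h @ rev (code_middle \<mu>) = []"
        using hd by (cases "b - first_row \<mu>") (auto simp: hstep_def)
      then show False using rev_eq assms(2) by (cases k) auto
    qed
    then have "replicate (first_row \<mu> - b) L @ rev (code_middle \<mu>) = replicate k L @ rev xs"
      using rev_eq by (simp add: hstep_def)
    then have "first_row \<mu> - b = k \<and> rev (code_middle \<mu>) = rev xs"
      by (rule replicate_append_eq_cancel) (use hd assms(3) in \<open>auto simp: hd_rev\<close>)
    with Nil assms(2) show ?thesis
      by (intro exI[of _ "[]"] exI[of _ b] exI[of _ \<mu>]) auto
  next
    case (snoc ys' y)
    with eq have y: "y = U" and eq': "code_middle \<mu> @ ?h = (xs @ replicate k L @ [U]) @ ys'"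
      by simp_all
    obtain zs where zs: "code_middle \<mu> = (xs @ replicate k L @ [U]) @ zs" "ys' = zs @ ?h"
    proof -
      from eq' consider us where "code_middle \<mu> = (xs @ replicate k L @ [U]) @ us" "us @ ?h = ys'"
        | us where "code_middle \<mu> @ us = xs @ replicate k L @ [U]" "?h = us @ ys'"
        unfolding append_eq_append_conv2 by blast
      then show ?thesis
      proof cases
        case 1
        with that show ?thesis by simp
      next
        case (2 us)
        \<comment> \<open>The block ends in U, whereas the horizontal step of the top row contains
          no U; the block therefore lies within the code of the remaining rows.\<close>
        have "us = []"
        proof (rule ccontr)
          assume "us \<noteq> []"
          then have "last us = U" using arg_cong[OF 2(1), of last] by simp
          with \<open>us \<noteq> []\<close> have "U \<in> set (us @ ys')" by (cases us rule: rev_cases) auto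
          then show False unfolding 2(2)[symmetric] using U_notin_hstep by simp
        qed
        with 2 that[of "[]"] show ?thesis by simp
      qed
    qed
    then obtain \<mu>' a \<kappa> where IH: "\<mu> = \<mu>' @ a # \<kappa>" "xs = code_middle \<kappa>" "first_row \<kappa> = a + k"
      "zs = code_above \<mu>' a"
      using Cons.IH[of zs] by auto
    have "first_row \<mu> = first_row (\<mu>' @ [a])"
      using IH(1) by (cases \<mu>') auto
    with IH snoc y zs show ?thesis
      by (intro exI[of _ "b # \<mu>'"] exI[of _ a] exI[of _ \<kappa>]) simp
  qed
qed

lemma glue_code_split:
  assumes same: "same_word (code \<mu>) (glue \<beta> (replicate k L @ [U]) \<gamma>)"
    and k: "k \<ge> 1" and \<beta>1: "\<beta> 1 = U"
  obtains xs ys where "code_middle \<mu> = xs @ replicate k L @ U # ys" "xs = [] \<or> last xs = U"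
    "\<And>i. i \<ge> 1 \<Longrightarrow> \<beta> i = (if i \<le> length xs then rev xs ! (i - 1) else U)"
    "\<And>i. i \<ge> 1 \<Longrightarrow> \<gamma> i = (if i \<le> length ys then ys ! (i - 1) else R)"
proof -
  define cm where "cm = code_middle \<mu>"
  let ?w = "glue \<beta> (replicate k L @ [U]) \<gamma>"
  obtain s where s: "\<And>i. ?w i = code \<mu> (i + s)"
    using same by (auto simp: same_word_def)
  \<comment> \<open>The letter after \<beta>_1 is L, and L occurs only in the finite part of a code.
    This confines the unknown shift s.\<close>
  have "code \<mu> s = L"
    using s[of 0] k by (simp add: glue_def nth_append)
  then have "0 \<le> s" "s < int (length cm)"
    by (auto simp: code_def glue_def cm_def split: if_splits)
  then obtain p where p: "s = int p" "p < length cm"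
    by (metis nonneg_int_cases of_nat_less_iff)
  have code: "code \<mu> (int j) = (if j < length cm then cm ! j else R)" for j
    by (simp add: code_def glue_def cm_def)
  have L: "(if p + j < length cm then cm ! (p + j) else R) = L" if "j < k" for j
    using s[of "int j"] that code[of "p + j"] p(1) by (simp add: glue_def nth_append add.commute)
  have U: "(if p + k < length cm then cm ! (p + k) else R) = U"
    using s[of "int k"] code[of "p + k"] p(1) by (simp add: glue_def nth_append add.commute)
  then have pk: "p + k < length cm" by (auto split: if_splits)
  define xs where "xs = take p cm"
  define ys where "ys = drop (Suc (p + k)) cm"
  have lx: "length xs = p" using p by (simp add: xs_def)
  have "take (Suc k) (drop p cm) = replicate k L @ [U]"
  proof (rule nth_equalityI)
    show "length (take (Suc k) (drop p cm)) = length (replicate k L @ [U])"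
      using pk by simp
    show "take (Suc k) (drop p cm) ! j = (replicate k L @ [U]) ! j"
      if "j < length (take (Suc k) (drop p cm))" for j
      using that L[of j] U pk by (auto simp: nth_append less_Suc_eq split: if_splits)
  qed
  then have "drop p cm = replicate k L @ U # ys"
    using append_take_drop_id[of "Suc k" "drop p cm"] by (simp add: ys_def add.commute)
  then have cm: "cm = xs @ replicate k L @ U # ys"
    using append_take_drop_id[of p cm] by (simp add: xs_def)
  have \<beta>: "\<beta> i = (if i \<le> length xs then rev xs ! (i - 1) else U)" if "i \<ge> 1" for i
  proof -
    have "\<beta> i = code \<mu> (- int i + s)"
      using s[of "- int i"] that by (simp add: glue_def)
    also have "\<dots> = (if i \<le> p then cm ! (p - i) else U)"
    proof (cases "i \<le> p")
      case True
      then have "- int i + s = int (p - i)" using p(1) by simp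
      moreover have "p - i < length cm" using pk by simp
      ultimately show ?thesis using True by (simp only: code if_True)
    qed (use p(1) in \<open>simp add: code_def glue_def\<close>)
    finally show ?thesis
      using that lx by (auto simp: rev_nth cm nth_append)
  qed
  have \<gamma>: "\<gamma> i = (if i \<le> length ys then ys ! (i - 1) else R)" if "i \<ge> 1" for i
  proof -
    have "\<gamma> i = ?w (int (k + i))"
      using that by (simp add: glue_def nat_int_add)
    also have "\<dots> = (if p + k + i < length cm then cm ! (p + k + i) else R)"
      using s[of "int (k + i)"] code[of "p + k + i"] p(1) by (simp add: add_ac)
    finally show ?thesis
      using that pk by (cases i) (auto simp: ys_def)
  qed
  have "xs = [] \<or> last xs = U"
    using \<beta>[of 1] \<beta>1 by (cases xs rule: rev_cases) auto
  with that cm \<beta> \<gamma> show ?thesis by (simp add: cm_def)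
qed

section \<open>Cancelling the remaining letters L\<close>

lemma cancel_step_glue: "cancel_step (glue \<beta> (us @ L # R # vs) \<gamma>) (glue \<beta> (us @ vs) \<gamma>)"
  unfolding cancel_step_def
proof (intro exI[of _ "int (length us)"] conjI ext)
  show "cancelling (glue \<beta> (us @ L # R # vs) \<gamma>) (int (length us))"
    by (simp add: cancelling_def glue_def nth_append nat_add_distrib)
  fix j
  show "glue \<beta> (us @ vs) \<gamma> j = (if j < int (length us) then glue \<beta> (us @ L # R # vs) \<gamma> j
      else glue \<beta> (us @ L # R # vs) \<gamma> (j + 2))"
  proof (cases "j < int (length us)")
    case True
    then show ?thesis by (simp add: glue_def nth_append nat_less_iff)
  next
    case False
    define i where "i = nat j - length us"
    with False have i: "j = int (length us + i)" by simp
    have "nat (j + 2) = length us + Suc (Suc i)" using i by simp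
    then show ?thesis by (simp add: i glue_def nth_append nat_int_add)
  qed
qed

lemma glue_snoc_R: "glue \<beta> (us @ [R]) (\<lambda>_. R) = glue \<beta> us (\<lambda>_. R)"
  by (auto simp: glue_def nth_append fun_eq_iff nat_less_iff)

text \<open>An L in front amounts to lengthening the row beneath by one box: it extends the next
  horizontal step if that row b satisfies b \<le> a, and otherwise cancels an R there. With no row
  above, the R comes from the x-axis.\<close>

lemma cancel_L_code_above:
  "cancel_step\<^sup>*\<^sup>* (glue \<beta> (us @ L # code_above \<mu> a) (\<lambda>_. R)) (glue \<beta> (us @ code_above \<mu> (Suc a)) (\<lambda>_. R))"
proof (cases \<mu> rule: rev_cases)
  case Nil
  have "cancel_step (glue \<beta> (us @ [L, R]) (\<lambda>_. R)) (glue \<beta> (us @ []) (\<lambda>_. R))"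
    by (rule cancel_step_glue)
  then show ?thesis using glue_snoc_R[of \<beta> "us @ [L]"] by (simp add: Nil r_into_rtranclp)
next
  case (snoc \<mu>' b)
  show ?thesis
  proof (cases "b \<le> a")
    case True
    then have "L # hstep a b = hstep (Suc a) b"
      by (auto simp: hstep_def Suc_diff_le)
    then have "us @ L # code_above \<mu> a = us @ code_above \<mu> (Suc a)"
      using snoc by (simp add: code_above_snoc flip: append_Cons)
    then show ?thesis by simp
  next
    case False
    then have "hstep a b = R # hstep (Suc a) b"
      by (simp add: hstep_def flip: replicate_Suc)
    then show ?thesis
      using snoc cancel_step_glue by (auto simp: code_above_snoc intro!: r_into_rtranclp)
  qed
qed

lemma cancel_replicate_L_code_above:
  "cancel_step\<^sup>*\<^sup>* (glue \<beta> (replicate n L @ code_above \<mu> a) (\<lambda>_. R)) (glue \<beta> (code_above \<mu> (a + n)) (\<lambda>_. R))"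
proof (induction n arbitrary: a)
  case (Suc n)
  have "replicate (Suc n) L @ code_above \<mu> a = replicate n L @ L # code_above \<mu> a"
    by (simp add: replicate_app_Cons_same)
  with cancel_L_code_above[of \<beta> "replicate n L" \<mu> a] Suc[of "Suc a"] show ?case
    by simp
qed simp

section \<open>Codes are reduced words\<close>

text \<open>Every horizontal step repeats a single letter, and different steps are separated by
  U.\<close>

lemma code_middle_reduced:
  "successively (\<lambda>x y. \<not> (x = L \<and> y = R \<or> x = R \<and> y = L)) (code_middle \<mu>)"
  (is "successively ?P _")
proof (induction \<mu>)
  case (Cons a \<mu>)
  have rep: "successively ?P (replicate n x)" for n x
  proof (induction n)
    case (Suc n)
    then show ?case by (cases n) auto
  qed simp
  have "last (code_middle \<mu>) = U" if "\<mu> \<noteq> []"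
    using that by (rule last_code_middle)
  with Cons rep show ?case
    by (cases "\<mu> = []") (auto simp: code_middle_Cons successively_append_iff hstep_def)
qed simp

lemma not_cancelling_code: "\<not> cancelling (code \<mu>) i"
proof -
  let ?cm = "code_middle \<mu>"
  have code: "code \<mu> i = (if i < 0 then U else if i < int (length ?cm) then ?cm ! nat i else R)" for i
    by (simp add: code_def glue_def)
  consider "i < 0" | "i \<ge> 0" "i + 1 < int (length ?cm)" | "i \<ge> 0" "i + 1 = int (length ?cm)"
    | "i \<ge> int (length ?cm)"
    by linarith
  then show ?thesis
  proof cases
    case 2
    then have "\<not> (?cm ! nat i = L \<and> ?cm ! Suc (nat i) = R \<or> ?cm ! nat i = R \<and> ?cm ! Suc (nat i) = L)"
      using code_middle_reduced[of \<mu>] by (auto simp: successively_conv_nth)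
    with 2 show ?thesis by (simp add: cancelling_def code Suc_nat_eq_nat_zadd1 add.commute)
  next
    case 3
    then have "?cm \<noteq> []" by auto
    then have "last ?cm = U" by (metis code_middle.simps(1) last_code_middle)
    moreover have "nat i = length ?cm - 1" using 3 by simp
    ultimately have "?cm ! nat i = U" using \<open>?cm \<noteq> []\<close> by (simp add: last_conv_nth)
    with 3 show ?thesis by (simp add: cancelling_def code)
  qed (auto simp: cancelling_def code)
qed

lemma is_reduced_formI:
  assumes "cancel_step\<^sup>*\<^sup>* w u" "\<And>i. code \<nu> i = u (i + s)"
  shows "is_reduced_form w (code \<nu>)"
proof -
  have "\<not> cancelling u i" for i
    using not_cancelling_code[of \<nu> "i - s"] assms(2)[of "i - s"] assms(2)[of "i + 1 - s"]
    by (simp add: cancelling_def algebra_simps)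
  with assms show ?thesis by (auto simp: is_reduced_form_def same_word_def)
qed

text \<open>The origin of \<open>code\<close> lies at the start of the finite part, that of
  \<open>glue\<close> between \<open>xs\<close> and \<open>ys\<close>; hence the shift by the length
  of \<open>xs\<close>.\<close>

lemma code_append_eq_glue:
  assumes "code_middle \<nu> = xs @ ys"
    and "\<And>i. i \<ge> 1 \<Longrightarrow> \<beta> i = (if i \<le> length xs then rev xs ! (i - 1) else U)"
  shows "code \<nu> i = glue \<beta> ys (\<lambda>_. R) (i + - int (length xs))"
proof -
  consider "i < 0" | "0 \<le> i" "i < int (length xs)" | "int (length xs) \<le> i"
    by linarith
  then show ?thesis
  proof cases
    case 1
    then have "\<not> nat (int (length xs) - i) \<le> length xs" "nat (int (length xs) - i) \<ge> 1" by auto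
    with 1 assms(2)[of "nat (int (length xs) - i)"] show ?thesis
      by (simp add: code_def glue_def)
  next
    case 2
    then have n: "nat (int (length xs) - i) = length xs - nat i" "nat i < length xs" by auto
    then have "\<beta> (length xs - nat i) = xs ! nat i"
      using assms(2)[of "length xs - nat i"] by (simp add: rev_nth)
    with 2 n show ?thesis
      by (simp add: code_def glue_def assms(1) nth_append)
  next
    case 3
    then have "\<not> i < 0" "\<not> nat i < length xs" "nat (i + - int (length xs)) = nat i - length xs"
      by simp_all
    with 3 show ?thesis by (simp add: code_def glue_def assms(1) nth_append)
  qed
qed

theorem theorem4p2:
  fixes \<mu> :: "nat list" and m k :: nat and \<beta> \<gamma> :: "nat \<Rightarrow> letter"
  assumes "is_composition m \<mu>"
    and "k \<ge> 1"
    and "same_word (code \<mu>) (glue \<beta> (replicate k L @ [U]) \<gamma>)"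
    and "\<forall>i\<ge>1. \<beta> i \<in> {R, U}"
    and "\<beta> 1 = U"
  shows "(\<beta> k = U \<longrightarrow> bernstein_prod \<mu> = (\<lambda>f. 0)) \<and>
         (\<beta> k = R \<longrightarrow>
           (\<exists>\<nu>. is_composition m \<nu> \<and> length \<nu> = length \<mu> \<and>
                is_reduced_form (glue (\<beta>(k := U)) (replicate (k - 1) L) \<gamma>) (code \<nu>) \<and>
                bernstein_prod \<mu> =
                  (\<lambda>f. (- 1) ^ card {i \<in> {1..<k}. \<beta> i = U} * bernstein_prod \<nu> f)))"
proof -
  obtain xs ys where xs: "code_middle \<mu> = xs @ replicate k L @ U # ys" "xs = [] \<or> last xs = U"
    and \<beta>: "\<And>i. i \<ge> 1 \<Longrightarrow> \<beta> i = (if i \<le> length xs then rev xs ! (i - 1) else U)"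
    and \<gamma>: "\<And>i. i \<ge> 1 \<Longrightarrow> \<gamma> i = (if i \<le> length ys then ys ! (i - 1) else R)"
    by (rule glue_code_split[OF assms(3,2,5)]) (rule that)
  obtain \<mu>' a \<kappa> where \<mu>: "\<mu> = \<mu>' @ a # \<kappa>" "xs = code_middle \<kappa>" "first_row \<kappa> = a + k"
    "ys = code_above \<mu>' a"
    using code_middle_split[OF xs(1) assms(2) xs(2)] by blast
  \<comment> \<open>The letters \<beta>_i spell \<open>xs\<close> backwards, so the hypothesis on
    them makes the rows below the block weakly decreasing.\<close>
  have "L \<notin> set xs"
  proof
    assume "L \<in> set xs"
    then obtain i where "i < length xs" "rev xs ! i = L"
      by (metis in_set_conv_nth length_rev set_rev)
    then have "\<beta> (Suc i) = L" using \<beta>[of "Suc i"] by simp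
    with assms(4)[rule_format, of "Suc i"] show False by simp
  qed
  then have sorted: "sorted_wrt (\<ge>) \<kappa>"
    unfolding \<mu>(2) by (rule sorted_if_no_L)
  have pos: "\<forall>x\<in>set \<mu>. 0 < x" "sum_list \<mu> = m"
    using assms(1) by (auto simp: is_composition_def)
  have k: "k \<le> length xs"
    using first_row_le_length_code[of \<kappa>] \<mu> by simp
  then have \<beta>k: "\<beta> k = rev (code_middle \<kappa>) ! (k - 1)"
    using \<beta>[OF assms(2)] \<mu>(2) by simp
  have straighten: "(\<beta> k = U \<longrightarrow> (\<forall>f. bernstein_prod (a # \<kappa>) f = 0)) \<and>
    (\<beta> k = R \<longrightarrow>
      (\<exists>\<nu>. length \<nu> = Suc (length \<kappa>) \<and> (\<forall>x\<in>set \<nu>. 0 < x) \<and> sum_list \<nu> = a + sum_list \<kappa> \<and>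
        first_row \<nu> = first_row \<kappa> - 1 \<and>
        rev (code_middle \<nu>) = (rev (code_middle \<kappa>))[k - 1 := U] \<and>
        (\<forall>f. bernstein_prod (a # \<kappa>) f =
          (- 1) ^ length (filter ((=) U) (take (k - 1) (rev (code_middle \<kappa>)))) * bernstein_prod \<nu> f)))"
    unfolding \<beta>k using sorted pos \<mu> assms(2) by (intro bernstein_straighten) auto
  show ?thesis
  proof (intro conjI impI)
    assume "\<beta> k = U"
    with straighten show "bernstein_prod \<mu> = (\<lambda>f. 0)"
      by (simp add: \<mu>(1) bernstein_prod_append module_hom.zero[OF linear_op_bernstein_prod] fun_eq_iff)
  next
    assume "\<beta> k = R"
    then obtain \<nu> where \<nu>: "length \<nu> = Suc (length \<kappa>)" "\<forall>x\<in>set \<nu>. 0 < x"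
        "sum_list \<nu> = a + sum_list \<kappa>" "first_row \<nu> = a + (k - 1)"
        "rev (code_middle \<nu>) = (rev xs)[k - 1 := U]"
        "\<And>f. bernstein_prod (a # \<kappa>) f =
          (- 1) ^ length (filter ((=) U) (take (k - 1) (rev xs))) * bernstein_prod \<nu> f"
      using straighten \<mu>(2,3) assms(2) by auto
    have "length (filter ((=) U) (take (k - 1) (rev xs)))
        = card {i. i < k - 1 \<and> U = rev xs ! i}"
      using k by (subst length_filter_conv_card) (auto intro!: arg_cong[of _ _ card])
    also have "\<dots> = card (Suc ` {i. i < k - 1 \<and> U = rev xs ! i})"
      by (simp add: card_image)
    \<comment> \<open>Lists are indexed from 0, the letters \<beta>_i from 1.\<close>
    also have "Suc ` {i. i < k - 1 \<and> U = rev xs ! i} = {i \<in> {1..<k}. \<beta> i = U}"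
    proof -
      have "i \<in> Suc ` {i. i < k - 1 \<and> U = rev xs ! i} \<longleftrightarrow> i \<in> {i \<in> {1..<k}. \<beta> i = U}" for i
        using k \<beta>[of i] by (cases i) auto
      then show ?thesis by blast
    qed
    finally have count: "length (filter ((=) U) (take (k - 1) (rev xs)))
        = card {i \<in> {1..<k}. \<beta> i = U}" .
    have comp: "is_composition m (\<mu>' @ \<nu>)"
      using pos \<nu> \<mu>(1) by (auto simp: is_composition_def)
    have prod: "bernstein_prod \<mu> =
        (\<lambda>f. (- 1) ^ card {i \<in> {1..<k}. \<beta> i = U} * bernstein_prod (\<mu>' @ \<nu>) f)"
      by (simp only: fun_eq_iff \<mu>(1) bernstein_prod_append \<nu>(6) count
          linear_op_minus_one_power[OF linear_op_bernstein_prod]) simp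
    let ?\<beta> = "\<beta>(k := U)"
    have start: "glue ?\<beta> (replicate (k - 1) L) \<gamma> =
        glue ?\<beta> (replicate (k - 1) L @ code_above \<mu>' a) (\<lambda>_. R)"
      using \<gamma> \<mu>(4) by (auto simp: fun_eq_iff glue_def nth_append)
    have \<beta>': "?\<beta> i = (if i \<le> length (code_middle \<nu>) then rev (code_middle \<nu>) ! (i - 1) else U)"
      if "i \<ge> 1" for i
    proof -
      have "length (code_middle \<nu>) = length xs"
        using arg_cong[OF \<nu>(5), of length] by simp
      then show ?thesis
        using \<beta>[OF that] that k assms(2) by (auto simp: \<nu>(5) nth_list_update)
    qed
    \<comment> \<open>The first row below \<open>\<mu>'\<close> is now a + (k - 1), and the k - 1
      remaining letters L adjust \<open>code_above\<close> from a to exactly this value.\<close>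
    have "code_middle (\<mu>' @ \<nu>) = code_middle \<nu> @ code_above \<mu>' (a + (k - 1))"
      by (simp add: code_middle_append \<nu>(4))
    from is_reduced_formI[OF cancel_replicate_L_code_above code_append_eq_glue[OF this \<beta>']]
    have "is_reduced_form (glue ?\<beta> (replicate (k - 1) L) \<gamma>) (code (\<mu>' @ \<nu>))"
      unfolding start .
    with comp prod \<nu>(1) \<mu>(1) show "\<exists>\<nu>. is_composition m \<nu> \<and> length \<nu> = length \<mu> \<and>
        is_reduced_form (glue ?\<beta> (replicate (k - 1) L) \<gamma>) (code \<nu>) \<and>
        bernstein_prod \<mu> = (\<lambda>f. (- 1) ^ card {i \<in> {1..<k}. \<beta> i = U} * bernstein_prod \<nu> f)"
      by (intro exI[of _ "\<mu>' @ \<nu>"]) simp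
  qed
qed

end
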